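(* Let $\kappa\geq\omega$, let $U$ be an ultrafilter over $\kappa$, and let $\mathbb{P}$ be any directed set. The following are equivalent: (1) $\mathbb{P}\leq_T (U,\supseteq)$. (2) There is a thin cover $X\in M_U$ of $j_U''\mathbb{P}$, i.e. an $X\in M_U$ such that $M_U\models j_U(p)\in X$ for every $p\in\mathbb{P}$, and such that for every unbounded set $\mathcal{A}\subseteq\mathbb{P}$, $j_U(\mathcal{A})\not\subseteq X$ (meaning there is $q$ with $M_U\models q\in j_U(\mathcal{A})\wedge q\notin X$).
   Context: A directed set is a partially ordered set in which any two elements have a common upper bound. A subset of a directed set is unbounded if it has no upper bound. For directed sets $\mathbb{P},\mathbb{Q}$, a Tukey map $f:\mathbb{P}\to\mathbb{Q}$ is a map sending every unbounded subset of $\mathbb{P}$ to an unbounded subset of $\mathbb{Q}$; $\mathbb{P}\leq_T\mathbb{Q}$ means there is a Tukey map from $\mathbb{P}$ to $\mathbb{Q}$. For an ultrafilter $U$, $(U,\supseteq)$ is $U$ ordered by reverse inclusion (so an upper bound of $\mathcal{A}\subseteq U$ is some $B\in U$ contained in every member of $\mathcal{A}$). $j_U:V\to M_U$ denotes the ultrapower embedding by $U$ (the ultrapower $M_U$ need not be well-founded; membership in $M_U$ is always meant in the sense of $M_U$). *)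

theory Defs
  imports Main
begin

text \<open>
  The universe \<open>V\<close> is a type \<open>'v\<close> of sets; \<open>elts x\<close> is the collection of elements of \<open>x\<close>.
  It is required to satisfy extensionality and separation, the latter for arbitrary subcollections:
  as in ZFC, every subcollection of a set is a set. These are the only set-theoretic axioms that
  are imposed, so the universe of ZFC is covered, and so is every ordinary HOL type (see the lemma
  after the definition).
\<close>

definition set_universe :: "('v \<Rightarrow> 'v set) \<Rightarrow> bool" where
  "set_universe elts \<longleftrightarrow>
     (\<forall>x y. elts x = elts y \<longrightarrow> x = y) \<and>
     (\<forall>x S. S \<subseteq> elts x \<longrightarrow> (\<exists>y. elts y = S))"

text \<open>
  The subsets of a HOL type \<open>'a\<close> form a universe if each \<open>a\<close> is identified with a set \<open>{a}\<close> that
  is its own only element. Hence any directed set in any HOL type occurs, up to renaming its points,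
  as an element of a universe.
\<close>

lemma set_universe_of_type: "set_universe (\<lambda>A :: 'a set. (\<lambda>a. {a}) ` A)"
  by (auto simp: set_universe_def subset_image_iff inj_image_eq_iff)

definition directed_set :: "'a set \<Rightarrow> 'a rel \<Rightarrow> bool" where
  "directed_set P r \<longleftrightarrow>
     partial_order_on P r \<and> (\<forall>x\<in>P. \<forall>y\<in>P. \<exists>z\<in>P. (x, z) \<in> r \<and> (y, z) \<in> r)"

definition unbounded_subset :: "'a set \<Rightarrow> 'a rel \<Rightarrow> 'a set \<Rightarrow> bool" where
  "unbounded_subset P r S \<longleftrightarrow> S \<subseteq> P \<and> \<not> (\<exists>b\<in>P. \<forall>s\<in>S. (s, b) \<in> r)"

definition tukey_map :: "'a set \<Rightarrow> 'a rel \<Rightarrow> 'b set \<Rightarrow> 'b rel \<Rightarrow> ('a \<Rightarrow> 'b) \<Rightarrow> bool" where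
  "tukey_map P r Q s f \<longleftrightarrow>
     f ` P \<subseteq> Q \<and> (\<forall>S. unbounded_subset P r S \<longrightarrow> unbounded_subset Q s (f ` S))"

definition tukey_le :: "'a set \<Rightarrow> 'a rel \<Rightarrow> 'b set \<Rightarrow> 'b rel \<Rightarrow> bool" where
  "tukey_le P r Q s \<longleftrightarrow> (\<exists>f. tukey_map P r Q s f)"

definition ultrafilter_over :: "'k set \<Rightarrow> 'k set set \<Rightarrow> bool" where
  "ultrafilter_over \<kappa> U \<longleftrightarrow>
     U \<subseteq> Pow \<kappa> \<and> \<kappa> \<in> U \<and> {} \<notin> U \<and>
     (\<forall>A\<in>U. \<forall>B\<in>U. A \<inter> B \<in> U) \<and>
     (\<forall>A\<in>U. \<forall>B. A \<subseteq> B \<and> B \<subseteq> \<kappa> \<longrightarrow> B \<in> U) \<and>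
     (\<forall>A. A \<subseteq> \<kappa> \<longrightarrow> A \<in> U \<or> \<kappa> - A \<in> U)"

definition reverse_inclusion :: "'k set set \<Rightarrow> 'k set rel" where
  "reverse_inclusion U = {(A, B). A \<in> U \<and> B \<in> U \<and> A \<supseteq> B}"

text \<open>
  A function from \<open>\<kappa>\<close> to \<open>V\<close> is represented by a total function on the type of \<open>\<kappa>\<close>; the values
  outside \<open>\<kappa>\<close> do not matter, since equality and membership modulo \<open>U\<close> only look at \<open>\<kappa>\<close>.
\<close>

definition eq_mod :: "'k set \<Rightarrow> 'k set set \<Rightarrow> ('k \<Rightarrow> 'v) rel" where
  "eq_mod \<kappa> U = {(f, g). {\<alpha>\<in>\<kappa>. f \<alpha> = g \<alpha>} \<in> U}"

definition ultrapower :: "'k set \<Rightarrow> 'k set set \<Rightarrow> ('k \<Rightarrow> 'v) set set" where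
  "ultrapower \<kappa> U = UNIV // eq_mod \<kappa> U"

definition ult_mem ::
    "('v \<Rightarrow> 'v set) \<Rightarrow> 'k set \<Rightarrow> 'k set set \<Rightarrow> ('k \<Rightarrow> 'v) set \<Rightarrow> ('k \<Rightarrow> 'v) set \<Rightarrow> bool" where
  "ult_mem elts \<kappa> U x y \<longleftrightarrow> (\<exists>f\<in>x. \<exists>g\<in>y. {\<alpha>\<in>\<kappa>. f \<alpha> \<in> elts (g \<alpha>)} \<in> U)"

definition ult_embedding :: "'k set \<Rightarrow> 'k set set \<Rightarrow> 'v \<Rightarrow> ('k \<Rightarrow> 'v) set" where
  "ult_embedding \<kappa> U x = eq_mod \<kappa> U `` {\<lambda>_. x}"

definition thin_cover ::
    "('v \<Rightarrow> 'v set) \<Rightarrow> 'k set \<Rightarrow> 'k set set \<Rightarrow> 'v \<Rightarrow> 'v rel \<Rightarrow> ('k \<Rightarrow> 'v) set \<Rightarrow> bool" where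
  "thin_cover elts \<kappa> U P le X \<longleftrightarrow>
     X \<in> ultrapower \<kappa> U \<and>
     (\<forall>p\<in>elts P. ult_mem elts \<kappa> U (ult_embedding \<kappa> U p) X) \<and>
     (\<forall>A. unbounded_subset (elts P) le (elts A) \<longrightarrow>
        (\<exists>q\<in>ultrapower \<kappa> U.
           ult_mem elts \<kappa> U q (ult_embedding \<kappa> U A) \<and> \<not> ult_mem elts \<kappa> U q X))"

end

(* A function g on \<kappa> with values in P(P) and a function f from P to subsets of \<kappa> are
   two views of one relation on P \<times> \<kappa>: p \<in> g \<alpha> iff \<alpha> \<in> f p. By Los's theorem for membership,
   j(p) \<in> [g] says that f p \<in> U, and j(A) \<subseteq> [g] says that A \<subseteq> g \<alpha> for U-almost all \<alpha>,
   that is, that f ` A has an upper bound in (U, \<supseteq>). *)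
theory Submission
  imports Defs
begin

lemma set_universe_separation:
  assumes "set_universe elts" and "S \<subseteq> elts x"
  shows "\<exists>y. elts y = S"
  using assms(1)[unfolded set_universe_def, THEN conjunct2] assms(2) by simp

lemma ultrafilter_overD:
  assumes "ultrafilter_over \<kappa> U"
  shows ultrafilter_subset: "A \<in> U \<Longrightarrow> A \<subseteq> \<kappa>"
    and ultrafilter_top: "\<kappa> \<in> U"
    and ultrafilter_Int: "A \<in> U \<Longrightarrow> B \<in> U \<Longrightarrow> A \<inter> B \<in> U"
    and ultrafilter_mono: "A \<in> U \<Longrightarrow> A \<subseteq> B \<Longrightarrow> B \<subseteq> \<kappa> \<Longrightarrow> B \<in> U"
    and ultrafilter_Compl: "A \<subseteq> \<kappa> \<Longrightarrow> \<kappa> - A \<in> U \<longleftrightarrow> A \<notin> U"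
proof -
  note U = assms[unfolded ultrafilter_over_def]
  show "A \<in> U \<Longrightarrow> A \<subseteq> \<kappa>" and "\<kappa> \<in> U"
    using U by auto
  show Int: "A \<in> U \<Longrightarrow> B \<in> U \<Longrightarrow> A \<inter> B \<in> U" for A B
    using U by simp
  show "A \<in> U \<Longrightarrow> A \<subseteq> B \<Longrightarrow> B \<subseteq> \<kappa> \<Longrightarrow> B \<in> U"
    using U by metis
  have "\<not> (A \<in> U \<and> \<kappa> - A \<in> U)"
    using U Int[of A "\<kappa> - A"] by auto
  then show "A \<subseteq> \<kappa> \<Longrightarrow> \<kappa> - A \<in> U \<longleftrightarrow> A \<notin> U"
    using U by metis
qed

lemma class_in_ultrapower: "eq_mod \<kappa> U `` {f} \<in> ultrapower \<kappa> U"
  by (simp add: ultrapower_def quotientI)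

lemma ultrapower_cases:
  assumes "x \<in> ultrapower \<kappa> U"
  obtains f where "x = eq_mod \<kappa> U `` {f}"
  using assms by (auto simp: ultrapower_def elim: quotientE)

text \<open>This is the atomic case of Los's theorem. \<open>ult_mem\<close> only asks for some pair
  of representatives, but replacing both representatives changes the truth set only off an
  intersection of two sets in \<open>U\<close>, so every pair gives the same answer.\<close>

lemma ult_mem_class_iff:
  assumes U: "ultrafilter_over \<kappa> U"
  shows "ult_mem elts \<kappa> U (eq_mod \<kappa> U `` {f}) (eq_mod \<kappa> U `` {g}) \<longleftrightarrow>
    {\<alpha>\<in>\<kappa>. f \<alpha> \<in> elts (g \<alpha>)} \<in> U"
proof
  assume "ult_mem elts \<kappa> U (eq_mod \<kappa> U `` {f}) (eq_mod \<kappa> U `` {g})"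
  then obtain f' g' where "{\<alpha>\<in>\<kappa>. f \<alpha> = f' \<alpha>} \<in> U" "{\<alpha>\<in>\<kappa>. g \<alpha> = g' \<alpha>} \<in> U"
      "{\<alpha>\<in>\<kappa>. f' \<alpha> \<in> elts (g' \<alpha>)} \<in> U"
    by (auto simp: ult_mem_def eq_mod_def)
  then have "{\<alpha>\<in>\<kappa>. f \<alpha> = f' \<alpha>} \<inter> {\<alpha>\<in>\<kappa>. g \<alpha> = g' \<alpha>} \<inter> {\<alpha>\<in>\<kappa>. f' \<alpha> \<in> elts (g' \<alpha>)} \<in> U"
    by (intro ultrafilter_Int[OF U])
  then show "{\<alpha>\<in>\<kappa>. f \<alpha> \<in> elts (g \<alpha>)} \<in> U"
    by (rule ultrafilter_mono[OF U]) auto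
next
  assume "{\<alpha>\<in>\<kappa>. f \<alpha> \<in> elts (g \<alpha>)} \<in> U"
  \<comment> \<open>Each function represents its own class because \<kappa> is in \<open>U\<close>;
    thus \<open>f\<close> and \<open>g\<close> themselves are the representatives that
    \<open>ult_mem\<close> asks for.\<close>
  moreover have "h \<in> eq_mod \<kappa> U `` {h}" for h :: "'a \<Rightarrow> 'b"
    using ultrafilter_top[OF U] by (simp add: eq_mod_def)
  ultimately show "ult_mem elts \<kappa> U (eq_mod \<kappa> U `` {f}) (eq_mod \<kappa> U `` {g})"
    unfolding ult_mem_def by blast
qed

text \<open>Inclusion is not atomic: its quantifier over members is handled by choosing, at each
  index where inclusion fails, one counterexample. The ultrafilter property makes the set of such
  indices large as soon as \<open>?B\<close> is not.\<close>

lemma ult_embedding_subset_iff: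
  assumes U: "ultrafilter_over \<kappa> U"
  shows "(\<forall>q\<in>ultrapower \<kappa> U. ult_mem elts \<kappa> U q (ult_embedding \<kappa> U A) \<longrightarrow>
            ult_mem elts \<kappa> U q (eq_mod \<kappa> U `` {g})) \<longleftrightarrow>
         {\<alpha>\<in>\<kappa>. elts A \<subseteq> elts (g \<alpha>)} \<in> U" (is "?L \<longleftrightarrow> ?B \<in> U")
proof
  assume L: ?L
  show "?B \<in> U"
  proof (rule ccontr)
    assume "?B \<notin> U"
    then have B: "\<kappa> - ?B \<in> U"
      by (simp add: ultrafilter_Compl[OF U])
    \<comment> \<open>The pointwise counterexamples are glued into one function \<open>q\<close>,
      whose values on \<open>?B\<close> are arbitrary. Its class lies in the image of
      \<open>A\<close> but not in the class of \<open>g\<close>.\<close>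
    have "\<forall>\<alpha>\<in>\<kappa> - ?B. \<exists>x. x \<in> elts A - elts (g \<alpha>)"
      by blast
    then obtain q where q: "\<And>\<alpha>. \<alpha> \<in> \<kappa> - ?B \<Longrightarrow> q \<alpha> \<in> elts A - elts (g \<alpha>)"
      by metis
    have "{\<alpha>\<in>\<kappa>. q \<alpha> \<in> elts A} \<in> U"
      by (rule ultrafilter_mono[OF U B]) (use q in blast)+
    then have "{\<alpha>\<in>\<kappa>. q \<alpha> \<in> elts (g \<alpha>)} \<in> U"
      using L[rule_format, OF class_in_ultrapower, of q]
      by (simp add: ult_embedding_def ult_mem_class_iff[OF U])
    moreover have "\<kappa> - {\<alpha>\<in>\<kappa>. q \<alpha> \<in> elts (g \<alpha>)} \<in> U"
      by (rule ultrafilter_mono[OF U B]) (use q in blast)+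
    ultimately show False
      by (simp add: ultrafilter_Compl[OF U])
  qed
next
  assume B: "?B \<in> U"
  have "{\<alpha>\<in>\<kappa>. q \<alpha> \<in> elts (g \<alpha>)} \<in> U" if "{\<alpha>\<in>\<kappa>. q \<alpha> \<in> elts A} \<in> U" for q
    by (rule ultrafilter_mono[OF U ultrafilter_Int[OF U B that]]) auto
  then show ?L
    by (auto simp: ult_embedding_def ult_mem_class_iff[OF U] elim!: ultrapower_cases)
qed

text \<open>Thinness negates the inclusion characterised in \<open>ult_embedding_subset_iff\<close>.
  After this translation only sets of indices remain, and the ultrapower can be forgotten.\<close>

lemma thin_cover_class_iff:
  assumes U: "ultrafilter_over \<kappa> U"
  shows "thin_cover elts \<kappa> U P le (eq_mod \<kappa> U `` {g}) \<longleftrightarrow>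
    (\<forall>p\<in>elts P. {\<alpha>\<in>\<kappa>. p \<in> elts (g \<alpha>)} \<in> U) \<and>
    (\<forall>A. unbounded_subset (elts P) le (elts A) \<longrightarrow> {\<alpha>\<in>\<kappa>. elts A \<subseteq> elts (g \<alpha>)} \<notin> U)"
  unfolding thin_cover_def ult_embedding_subset_iff[OF U, symmetric]
  by (simp add: class_in_ultrapower ult_embedding_def ult_mem_class_iff[OF U])

text \<open>The intersection of \<open>F\<close> within \<kappa> is the largest candidate for an
  upper bound, and \<open>U\<close> is closed upwards, so a bound exists iff this candidate is in
  \<open>U\<close>. For empty \<open>F\<close> the candidate is \<kappa>.\<close>

lemma unbounded_reverse_inclusion_iff:
  assumes U: "ultrafilter_over \<kappa> U" and F: "F \<subseteq> U"
  shows "unbounded_subset U (reverse_inclusion U) F \<longleftrightarrow> {\<alpha>\<in>\<kappa>. \<forall>C\<in>F. \<alpha> \<in> C} \<notin> U"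
proof -
  let ?M = "{\<alpha>\<in>\<kappa>. \<forall>C\<in>F. \<alpha> \<in> C}"
  have "(\<exists>B\<in>U. \<forall>C\<in>F. B \<subseteq> C) \<longleftrightarrow> ?M \<in> U"
  proof
    assume "\<exists>B\<in>U. \<forall>C\<in>F. B \<subseteq> C"
    then obtain B where B: "B \<in> U" "\<forall>C\<in>F. B \<subseteq> C"
      by blast
    show "?M \<in> U"
      by (rule ultrafilter_mono[OF U B(1)]) (use B ultrafilter_subset[OF U] in auto)
  next
    assume "?M \<in> U"
    then show "\<exists>B\<in>U. \<forall>C\<in>F. B \<subseteq> C"
      by (rule bexI[rotated]) auto
  qed
  moreover have "(C, B) \<in> reverse_inclusion U \<longleftrightarrow> B \<subseteq> C" if "C \<in> F" "B \<in> U" for B C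
    using that F by (auto simp: reverse_inclusion_def)
  ultimately show ?thesis
    using F by (simp add: unbounded_subset_def)
qed

theorem mainTheorem1:
  fixes elts :: "'v \<Rightarrow> 'v set"
    and \<kappa> :: "'k set"
    and U :: "'k set set"
    and P :: 'v
    and le :: "'v rel"
  assumes "set_universe elts"
    and "infinite \<kappa>"
    and "ultrafilter_over \<kappa> U"
    and "directed_set (elts P) le"
  shows "tukey_le (elts P) le U (reverse_inclusion U) \<longleftrightarrow>
         (\<exists>X. thin_cover elts \<kappa> U P le X)"
proof
  note U = assms(3)
  assume "tukey_le (elts P) le U (reverse_inclusion U)"
  then obtain f where fU: "f ` elts P \<subseteq> U"
    and unb: "\<And>S. unbounded_subset (elts P) le S \<Longrightarrow>
                unbounded_subset U (reverse_inclusion U) (f ` S)"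
    unfolding tukey_le_def tukey_map_def by blast
  \<comment> \<open>Separation turns each fibre of the relation into an element of the universe, so
    that \<open>g\<close> can represent a point of the ultrapower.\<close>
  have "\<exists>y. elts y = {p \<in> elts P. \<alpha> \<in> f p}" for \<alpha>
    by (rule set_universe_separation[OF assms(1)]) auto
  then obtain g where g: "\<And>\<alpha>. elts (g \<alpha>) = {p \<in> elts P. \<alpha> \<in> f p}"
    by metis
  have "thin_cover elts \<kappa> U P le (eq_mod \<kappa> U `` {g})"
    unfolding thin_cover_class_iff[OF U]
  proof (intro conjI ballI allI impI)
    fix p assume "p \<in> elts P"
    with fU have "f p \<in> U" "{\<alpha>\<in>\<kappa>. p \<in> elts (g \<alpha>)} = f p"
      using ultrafilter_subset[OF U] by (auto simp: g)
    then show "{\<alpha>\<in>\<kappa>. p \<in> elts (g \<alpha>)} \<in> U"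
      by simp
  next
    fix A assume A: "unbounded_subset (elts P) le (elts A)"
    then have AP: "elts A \<subseteq> elts P"
      by (simp add: unbounded_subset_def)
    with fU have "f ` elts A \<subseteq> U"
      by blast
    with unb[OF A] have "{\<alpha>\<in>\<kappa>. \<forall>C\<in>f ` elts A. \<alpha> \<in> C} \<notin> U"
      by (simp add: unbounded_reverse_inclusion_iff[OF U])
    \<comment> \<open>The values of \<open>g\<close> contain only points of \<open>P\<close>, so the
      two sets agree because \<open>elts A\<close> is included in \<open>elts P\<close>.\<close>
    also have "{\<alpha>\<in>\<kappa>. \<forall>C\<in>f ` elts A. \<alpha> \<in> C} = {\<alpha>\<in>\<kappa>. elts A \<subseteq> elts (g \<alpha>)}"
      using AP by (auto simp: g)
    finally show "{\<alpha>\<in>\<kappa>. elts A \<subseteq> elts (g \<alpha>)} \<notin> U" .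
  qed
  then show "\<exists>X. thin_cover elts \<kappa> U P le X" ..
next
  note U = assms(3)
  assume "\<exists>X. thin_cover elts \<kappa> U P le X"
  then obtain X where X: "thin_cover elts \<kappa> U P le X" ..
  then obtain g where "X = eq_mod \<kappa> U `` {g}"
    unfolding thin_cover_def by (blast elim: ultrapower_cases)
  with X have cover: "\<And>p. p \<in> elts P \<Longrightarrow> {\<alpha>\<in>\<kappa>. p \<in> elts (g \<alpha>)} \<in> U"
    and thin: "\<And>A. unbounded_subset (elts P) le (elts A) \<Longrightarrow>
                 {\<alpha>\<in>\<kappa>. elts A \<subseteq> elts (g \<alpha>)} \<notin> U"
    by (simp_all add: thin_cover_class_iff[OF U])
  \<comment> \<open>For \<open>p\<close> outside \<open>elts P\<close> this set may fail to be in
    \<open>U\<close>, which is harmless since a Tukey map is constrained only on its domain.\<close>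
  define f where "f p = {\<alpha>\<in>\<kappa>. p \<in> elts (g \<alpha>)}" for p
  have "unbounded_subset U (reverse_inclusion U) (f ` S)"
    if S: "unbounded_subset (elts P) le S" for S
  proof -
    have SP: "S \<subseteq> elts P"
      using S by (simp add: unbounded_subset_def)
    \<comment> \<open>Tukey maps are tested on arbitrary subcollections \<open>S\<close>, thinness
      only on elements \<open>A\<close> of the universe; separation closes this gap.\<close>
    then obtain A where A: "elts A = S"
      using set_universe_separation[OF assms(1)] by metis
    have fS: "f ` S \<subseteq> U"
      using SP cover by (auto simp: f_def)
    have "{\<alpha>\<in>\<kappa>. \<forall>C\<in>f ` S. \<alpha> \<in> C} = {\<alpha>\<in>\<kappa>. elts A \<subseteq> elts (g \<alpha>)}"
      by (auto simp: f_def A)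
    with thin[of A] S A show ?thesis
      by (simp add: unbounded_reverse_inclusion_iff[OF U fS])
  qed
  moreover have "f ` elts P \<subseteq> U"
    using cover by (auto simp: f_def)
  ultimately show "tukey_le (elts P) le U (reverse_inclusion U)"
    unfolding tukey_le_def tukey_map_def by blast
qed

end
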